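(* For any finite group $G$, the vertex covering number of the enhanced power graph satisfies $\beta(\mathcal{P}_e(G)) = |G| - \mu(G)$, where $\mu(G)$ is the number of maximal cyclic subgroups of $G$.
   Context: The enhanced power graph $\mathcal{P}_e(G)$ of a group $G$ is the simple undirected graph with vertex set $G$ in which two distinct vertices are adjacent if and only if they belong to a common cyclic subgroup of $G$. A maximal cyclic subgroup of $G$ is a cyclic subgroup not properly contained in any other cyclic subgroup. A vertex cover of a graph $\Gamma$ is a set of vertices containing at least one endpoint of every edge; the vertex covering number $\beta(\Gamma)$ is the minimum cardinality of a vertex cover. *)

theory Defs
  imports "HOL-Algebra.Elementary_Groups" "Graph_Theory.Pair_Digraph"
begin

definition cyclic_subgroup :: "'a set \<Rightarrow> ('a, 'b) monoid_scheme \<Rightarrow> bool" where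
  "cyclic_subgroup C G \<longleftrightarrow> subgroup C G \<and> cyclic_group (G\<lparr>carrier := C\<rparr>)"

definition maximal_cyclic_subgroup :: "'a set \<Rightarrow> ('a, 'b) monoid_scheme \<Rightarrow> bool" where
  "maximal_cyclic_subgroup C G \<longleftrightarrow>
     cyclic_subgroup C G \<and> \<not> (\<exists>D. cyclic_subgroup D G \<and> C \<subset> D)"

text \<open>Undirected simple graphs are symmetric loop-free pair digraphs (locale \<open>pair_graph\<close>): an
  edge between \<open>u\<close> and \<open>v\<close> is represented by the two arcs \<open>(u, v)\<close> and \<open>(v, u)\<close>.\<close>

definition enhanced_power_graph :: "('a, 'b) monoid_scheme \<Rightarrow> 'a pair_pre_digraph" where
  "enhanced_power_graph G =
     \<lparr> pverts = carrier G,
       parcs = {(x, y). x \<in> carrier G \<and> y \<in> carrier G \<and> x \<noteq> y \<and>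
                        (\<exists>C. cyclic_subgroup C G \<and> x \<in> C \<and> y \<in> C)} \<rparr>"

lemma pair_graph_enhanced_power_graph:
  assumes "finite (carrier G)"
  shows "pair_graph (enhanced_power_graph G)"
proof
  have "parcs (enhanced_power_graph G) \<subseteq> carrier G \<times> carrier G"
    by (auto simp: enhanced_power_graph_def)
  then show "finite (parcs (enhanced_power_graph G))"
    using assms by (meson finite_SigmaI finite_subset)
qed (use assms in \<open>auto simp: enhanced_power_graph_def symmetric_def sym_def\<close>)

definition vertex_cover :: "'a pair_pre_digraph \<Rightarrow> 'a set \<Rightarrow> bool" where
  "vertex_cover \<Gamma> S \<longleftrightarrow> S \<subseteq> pverts \<Gamma> \<and> (\<forall>(u, v) \<in> parcs \<Gamma>. u \<in> S \<or> v \<in> S)"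

text \<open>Only finite covers are measured, since \<open>card\<close> of an infinite set is \<open>0\<close>. In a finite graph
  every cover is finite, and the set of all vertices is one, so the minimum exists.\<close>

definition vertex_covering_number :: "'a pair_pre_digraph \<Rightarrow> nat" where
  "vertex_covering_number \<Gamma> = (LEAST k. \<exists>S. vertex_cover \<Gamma> S \<and> finite S \<and> card S = k)"

definition num_maximal_cyclic_subgroups :: "('a, 'b) monoid_scheme \<Rightarrow> nat" where
  "num_maximal_cyclic_subgroups G = card {C. maximal_cyclic_subgroup C G}"

end

theory Submission
  imports Defs
begin

text \<open>Complements of vertex covers are the independent sets. Two elements of the same cyclic
  subgroup are adjacent or equal, so mapping each element of an independent set to some maximal
  cyclic subgroup containing it is injective. Conversely, choosing one generator from each maximal
  cyclic subgroup gives an independent set: a cyclic subgroup containing generators of two maximal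
  ones contains, hence equals, both.\<close>

context group
begin

text \<open>Integer powers of an element of a subgroup are the same computed there or in
  \<open>G\<close>. So cyclicity, defined through a restricted carrier, becomes a condition on
  powers in \<open>G\<close> itself.\<close>

lemma cyclic_subgroup_iff:
  "cyclic_subgroup C G \<longleftrightarrow> (\<exists>x\<in>carrier G. C = range (\<lambda>n::int. x [^] n))"
proof
  assume "cyclic_subgroup C G"
  then have sub: "subgroup C G" and cyc: "cyclic_group (G\<lparr>carrier := C\<rparr>)"
    by (auto simp: cyclic_subgroup_def)
  interpret C: group "G\<lparr>carrier := C\<rparr>"
    using sub by (rule subgroup_imp_group)
  obtain x where x: "x \<in> C" and "C = range (\<lambda>n::int. x [^]\<^bsub>G\<lparr>carrier := C\<rparr>\<^esub> n)"
    using cyc by (auto simp: C.cyclic_group)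
  then have "C = range (\<lambda>n::int. x [^] n)"
    by (simp flip: int_pow_consistent[OF sub x])
  with x show "\<exists>x\<in>carrier G. C = range (\<lambda>n::int. x [^] n)"
    using subgroup.mem_carrier[OF sub] by blast
next
  assume "\<exists>x\<in>carrier G. C = range (\<lambda>n::int. x [^] n)"
  then obtain x where x: "x \<in> carrier G" and C: "C = range (\<lambda>n::int. x [^] n)"
    by blast
  have sub: "subgroup C G"
    using subgroup_of_powers[OF x] C by simp
  interpret C: group "G\<lparr>carrier := C\<rparr>"
    using sub by (rule subgroup_imp_group)
  have mem: "x \<in> C"
    unfolding C using x by (metis int_pow_1 rangeI)
  have "C = range (\<lambda>n::int. x [^]\<^bsub>G\<lparr>carrier := C\<rparr>\<^esub> n)"
    unfolding int_pow_consistent[OF sub mem, symmetric] by (rule C)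
  with mem have "cyclic_group (G\<lparr>carrier := C\<rparr>)"
    unfolding C.cyclic_group partial_object.select_convs partial_object.update_convs by auto
  with sub show "cyclic_subgroup C G"
    by (simp add: cyclic_subgroup_def)
qed

text \<open>The witness is a generator of \<open>M\<close>: a subgroup containing it contains all
  its powers, hence \<open>M\<close>, and maximality forces equality.\<close>

lemma maximal_cyclic_subgroup_generator:
  assumes "maximal_cyclic_subgroup M G"
  obtains x where "x \<in> M" "\<And>C. cyclic_subgroup C G \<Longrightarrow> x \<in> C \<Longrightarrow> C = M"
proof -
  obtain x where x: "x \<in> carrier G" and M: "M = range (\<lambda>n::int. x [^] n)"
    using assms by (auto simp: maximal_cyclic_subgroup_def cyclic_subgroup_iff)
  show ?thesis
  proof
    show "x \<in> M"
      unfolding M using x by (metis int_pow_1 rangeI)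
    fix C assume C: "cyclic_subgroup C G" "x \<in> C"
    then have "M \<subseteq> C"
      unfolding M using subgroup_int_pow_closed by (auto simp: cyclic_subgroup_def)
    then show "C = M"
      using C assms by (auto simp: maximal_cyclic_subgroup_def)
  qed
qed

text \<open>A finite group has finitely many subgroups, so some maximal one among the cyclic
  subgroups lies above the powers of \<open>x\<close>. Finiteness matters: the additive group of the
  rationals has no maximal cyclic subgroup.\<close>

lemma maximal_cyclic_subgroup_exists:
  assumes "finite (carrier G)" and x: "x \<in> carrier G"
  obtains M where "maximal_cyclic_subgroup M G" "x \<in> M"
proof -
  let ?\<C> = "{C. cyclic_subgroup C G}" and ?X = "range (\<lambda>n::int. x [^] n)"
  have "?\<C> \<subseteq> Pow (carrier G)"
    by (auto simp: cyclic_subgroup_def dest: subgroup.mem_carrier)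
  then have "finite ?\<C>"
    using assms by (meson finite_Pow_iff finite_subset)
  moreover have "?X \<in> ?\<C>"
    using x by (auto simp: cyclic_subgroup_iff)
  ultimately obtain M where "M \<in> ?\<C>" "?X \<subseteq> M" "\<forall>C\<in>?\<C>. M \<subseteq> C \<longrightarrow> M = C"
    using finite_has_maximal2[of ?\<C> ?X] by auto
  moreover have "x \<in> ?X"
    using x by (metis int_pow_1 rangeI)
  ultimately show ?thesis
    by (intro that[of M]) (auto simp: maximal_cyclic_subgroup_def)
qed

lemma finite_maximal_cyclic_subgroups:
  assumes "finite (carrier G)"
  shows "finite {M. maximal_cyclic_subgroup M G}"
  by (rule finite_subset[of _ "Pow (carrier G)"])
     (use assms in \<open>auto simp: maximal_cyclic_subgroup_def cyclic_subgroup_def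
        dest: subgroup.mem_carrier\<close>)

text \<open>The lower bound for every cover, written as a sum to avoid truncated subtraction on
  natural numbers.\<close>

lemma card_vertex_cover_ge:
  assumes fin: "finite (carrier G)" and cover: "vertex_cover (enhanced_power_graph G) S"
  shows "order G \<le> card S + num_maximal_cyclic_subgroups G"
proof -
  have S: "S \<subseteq> carrier G"
    using cover by (simp add: vertex_cover_def enhanced_power_graph_def)
  have "\<forall>x\<in>carrier G - S. \<exists>M. maximal_cyclic_subgroup M G \<and> x \<in> M"
    using maximal_cyclic_subgroup_exists[OF fin] by (metis DiffD1)
  then obtain f where f: "\<And>x. x \<in> carrier G - S \<Longrightarrow> maximal_cyclic_subgroup (f x) G \<and> x \<in> f x"
    by metis
  have "inj_on f (carrier G - S)"
  proof (rule inj_onI, rule ccontr)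
    fix x y assume xy: "x \<in> carrier G - S" "y \<in> carrier G - S" "f x = f y" "x \<noteq> y"
    \<comment> \<open>The common value \<open>f x = f y\<close> is itself a cyclic subgroup
      containing both elements; the resulting edge misses \<open>S\<close>.\<close>
    then have "(x, y) \<in> parcs (enhanced_power_graph G)"
      using f[of x] f[of y]
      by (auto simp: enhanced_power_graph_def maximal_cyclic_subgroup_def)
    then show False
      using cover xy by (auto simp: vertex_cover_def)
  qed
  then have "card (carrier G - S) \<le> num_maximal_cyclic_subgroups G"
    unfolding num_maximal_cyclic_subgroups_def
    using f finite_maximal_cyclic_subgroups[OF fin] by (intro card_inj_on_le[of f]) auto
  then show ?thesis
    using S fin by (simp add: order_def card_Diff_subset finite_subset)
qed

lemma vertex_cover_attaining:
  assumes fin: "finite (carrier G)"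
  obtains S where "vertex_cover (enhanced_power_graph G) S"
    "card S + num_maximal_cyclic_subgroups G = order G"
proof -
  let ?\<M> = "{M. maximal_cyclic_subgroup M G}"
  have "\<forall>M\<in>?\<M>. \<exists>x. x \<in> M \<and> (\<forall>C. cyclic_subgroup C G \<longrightarrow> x \<in> C \<longrightarrow> C = M)"
    using maximal_cyclic_subgroup_generator by (metis mem_Collect_eq)
  then obtain g where g: "\<And>M. M \<in> ?\<M> \<Longrightarrow> g M \<in> M"
    and gen: "\<And>M C. M \<in> ?\<M> \<Longrightarrow> cyclic_subgroup C G \<Longrightarrow> g M \<in> C \<Longrightarrow> C = M"
    by metis
  have cyc: "cyclic_subgroup M G" if "M \<in> ?\<M>" for M
    using that by (simp add: maximal_cyclic_subgroup_def)
  have sub: "g ` ?\<M> \<subseteq> carrier G"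
    using g cyc by (auto simp: cyclic_subgroup_def dest: subgroup.mem_carrier)
  \<comment> \<open>If \<open>g M = g N\<close>, then \<open>g M\<close> lies in the cyclic subgroup
    \<open>N\<close>, so \<open>gen\<close> gives \<open>N = M\<close>.\<close>
  have "inj_on g ?\<M>"
    by (metis (no_types, lifting) inj_onI g gen cyc)
  then have "card (g ` ?\<M>) = num_maximal_cyclic_subgroups G"
    by (simp add: card_image num_maximal_cyclic_subgroups_def)
  then have "card (carrier G - g ` ?\<M>) + num_maximal_cyclic_subgroups G = order G"
    \<comment> \<open>\<open>card_mono\<close> ensures that the subtraction in
      \<open>card_Diff_subset\<close> is not truncated.\<close>
    using sub fin card_mono[OF fin sub]
    by (simp add: order_def card_Diff_subset finite_subset)
  \<comment> \<open>An uncovered edge would join some \<open>g M\<close> and \<open>g N\<close>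
    inside one cyclic \<open>C\<close>; then \<open>M = C = N\<close> by \<open>gen\<close>, so its
    ends would coincide.\<close>
  moreover have "vertex_cover (enhanced_power_graph G) (carrier G - g ` ?\<M>)"
    unfolding vertex_cover_def enhanced_power_graph_def using gen by auto
  ultimately show ?thesis
    using that by blast
qed

end

theorem corollary3p4:
  fixes G :: "('a, 'b) monoid_scheme"
  assumes "group G" and "finite (carrier G)"
  shows "int (vertex_covering_number (enhanced_power_graph G))
           = int (order G) - int (num_maximal_cyclic_subgroups G)"
proof -
  interpret group G by fact
  let ?\<Gamma> = "enhanced_power_graph G"
  obtain S where S: "vertex_cover ?\<Gamma> S" "card S + num_maximal_cyclic_subgroups G = order G"
    using vertex_cover_attaining[OF assms(2)] by blast
  have "finite S"
    using S(1) assms(2) by (auto simp: vertex_cover_def enhanced_power_graph_def finite_subset)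
  have "vertex_covering_number ?\<Gamma> = card S"
    unfolding vertex_covering_number_def
  proof (rule Least_equality)
    show "\<exists>T. vertex_cover ?\<Gamma> T \<and> finite T \<and> card T = card S"
      using S(1) \<open>finite S\<close> by blast
  next
    fix k assume "\<exists>T. vertex_cover ?\<Gamma> T \<and> finite T \<and> card T = k"
    then show "card S \<le> k"
      using card_vertex_cover_ge[OF assms(2)] S(2) by fastforce
  qed
  with S(2) show ?thesis
    by linarith
qed

end
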